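(* Let $k\ge 1$ and let $r(z)=p(z)/w(z) \in \mathcal{R}_n=\mathcal{R}_n(a_1,\dots,a_n)$, where $|a_j|>1$ for $1\le j\le n$, $p$ is a polynomial of degree $n$, and all zeros of $p$ lie in $\{z\in\mathbb{C}: |z|\ge k\}$. Let $m=\min_{|z|=k}|r(z)|$. Then for every $z\in\mathbb{C}$ with $|z|=1$, $$|r'(z)| \leq \frac{1}{2}\left[ |B'(z)| - \frac{n(k-1)\,(|r(z)|-m)^2}{(k+1)\,(\|r\|-m)^2}\right] (\|r\|-m).$$ Moreover, equality holds for $r(z) = \left(\dfrac{z+k}{z-a}\right)^n$ and $B(z) = \left(\dfrac{1-az}{z-a}\right)^n$ (i.e. $a_1=\dots=a_n=a$) evaluated at $z=1$, where $a>1$, $k\ge 1$.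
   Context: For complex numbers $a_1,\dots,a_n$ (not necessarily distinct) with $|a_j|>1$ for all $j$, put $w(z)=\prod_{j=1}^n (z-a_j)$ and $B(z)=\prod_{j=1}^n \dfrac{1-\overline{a_j}z}{z-a_j}$. Let $\mathcal{P}_n$ be the set of complex polynomials of degree at most $n$, and $\mathcal{R}_n=\mathcal{R}_n(a_1,\dots,a_n)=\{p(z)/w(z) : p\in\mathcal{P}_n\}$. $\|r\|=\sup_{|z|=1}|r(z)|$. In the definition of $m$, $|r|$ is regarded as $+\infty$ at any pole of $r$ on $|z|=k$. *)

theory Defs
  imports "HOL-Complex_Analysis.Complex_Analysis"
begin

definition pole_poly :: "nat \<Rightarrow> (nat \<Rightarrow> complex) \<Rightarrow> complex poly" where
  "pole_poly n a = (\<Prod>j=1..n. [:- a j, 1:])"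

definition blaschke :: "nat \<Rightarrow> (nat \<Rightarrow> complex) \<Rightarrow> complex \<Rightarrow> complex" where
  "blaschke n a z = (\<Prod>j=1..n. (1 - cnj (a j) * z) / (z - a j))"

text \<open>The rational function \<open>p / q\<close>. The polynomials may have common zeros; \<^const>\<open>remove_sings\<close>
  then supplies the value of the reduced fraction, where the pointwise quotient would be
  \<open>0 / 0 = 0\<close>. At a genuine pole the value is the dummy \<open>0\<close>.\<close>
definition rat_fun :: "complex poly \<Rightarrow> complex poly \<Rightarrow> complex \<Rightarrow> complex" where
  "rat_fun p q = remove_sings (\<lambda>z. poly p z / poly q z)"

definition circle_norm :: "(complex \<Rightarrow> complex) \<Rightarrow> real" where
  "circle_norm r = (SUP z\<in>sphere 0 1. cmod (r z))"

definition ext_cmod :: "(complex \<Rightarrow> complex) \<Rightarrow> complex \<Rightarrow> ereal" where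
  "ext_cmod r z = (if is_pole r z then \<infinity> else ereal (cmod (r z)))"

text \<open>The minimum of \<open>|r|\<close> on \<open>|z| = k\<close>. For a rational function the infimum is attained
  and finite: \<^term>\<open>ext_cmod r\<close> is continuous on the compact circle, and there are only
  finitely many poles.\<close>
definition circle_min :: "real \<Rightarrow> (complex \<Rightarrow> complex) \<Rightarrow> real" where
  "circle_min k r = real_of_ereal (INF z\<in>sphere 0 k. ext_cmod r z)"

end

theory Submission
  imports Defs "HOL-Computational_Algebra.Fundamental_Theorem_Algebra"
begin

text \<open>Fix \<open>z\<close> on the unit circle, put \<open>\<beta> = |B'(z)|\<close>, \<open>c = n (k - 1) / (k + 1)\<close> and, for
  \<open>s = q / w\<close>, \<open>T\<^sub>s = \<beta> s(z) - z s'(z)\<close>; then \<open>|T\<^sub>s| = |s\<^sup>*'(z)|\<close> for the reciprocal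
  \<open>s\<^sup>*\<close>, but only \<open>T\<^sub>s\<close> itself is needed. If all zeros of \<open>q\<close> satisfy \<open>|x| \<ge> k\<close>, then
  \<open>Re (z s'/s) \<le> (\<beta> - c) / 2\<close>, which says \<open>|s'|\<^sup>2 + \<beta> c |s|\<^sup>2 \<le> |T\<^sub>s|\<^sup>2\<close>. Adding a
  constant \<open>\<lambda>\<close> to \<open>r\<close> leaves \<open>r'\<close> unchanged and shifts \<open>T\<^sub>r\<close> by \<open>\<beta> \<lambda>\<close>. With
  \<open>M = \<parallel>r\<parallel>\<close>, the maximum principle keeps the zeros of \<open>p + \<lambda> w\<close> in \<open>|x| \<ge> 1\<close> for
  \<open>|\<lambda>| > M\<close> and in \<open>|x| \<ge> k\<close> for \<open>|\<lambda>| < m\<close>. Choosing the argument of \<open>\<lambda>\<close> opposite to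
  that of \<open>T\<^sub>r\<close> gives \<open>|r'| + |T\<^sub>r| \<le> \<beta> M\<close> in the first case and
  \<open>|r'|\<^sup>2 + \<beta> c (|r| - m)\<^sup>2 \<le> (|T\<^sub>r| - \<beta> m)\<^sup>2\<close> in the second, and eliminating \<open>|T\<^sub>r|\<close>
  yields the bound.\<close>

text \<open>Each summand is the Poisson kernel for a point outside the closed disc. On the unit
  circle the sum equals \<open>z * B' / B\<close>, hence |B'|, which is the \<beta> of the
  overview.\<close>

definition poisson_sum :: "nat \<Rightarrow> (nat \<Rightarrow> complex) \<Rightarrow> complex \<Rightarrow> real" where
  "poisson_sum n a z = (\<Sum>j=1..n. ((cmod (a j))\<^sup>2 - 1) / (cmod (z - a j))\<^sup>2)"

text \<open>An explicit quotient rule: perturbing \<open>p\<close> by multiples of \<open>q\<close>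
  becomes polynomial algebra, and \<open>deriv_rat_fun\<close> returns to the analytic
  derivative.\<close>

definition quot_deriv :: "complex poly \<Rightarrow> complex poly \<Rightarrow> complex \<Rightarrow> complex" where
  "quot_deriv p q z = poly (pderiv p * q - p * pderiv q) z / (poly q z)\<^sup>2"

section \<open>Logarithmic derivatives of polynomials on the unit circle\<close>

text \<open>Polarization: for |z| = 1, twice the real part of \<open>z * cnj (z - b)\<close> is |z -
  b|^2 + 1 - |b|^2; then divide by |z - b|^2.\<close>

lemma Re_divide_diff:
  assumes "cmod z = 1" "z \<noteq> b"
  shows "Re (z / (z - b)) = (1 - ((cmod b)\<^sup>2 - 1) / (cmod (z - b))\<^sup>2) / 2"
proof -
  have z: "(Re z)\<^sup>2 + (Im z)\<^sup>2 = 1"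
    using assms(1) by (metis cmod_power2 one_power2)
  have pos: "(cmod (z - b))\<^sup>2 > 0"
    using assms(2) by simp
  have "Re (z / (z - b)) = (Re z * (Re z - Re b) + Im z * (Im z - Im b)) / (cmod (z - b))\<^sup>2"
    by (simp add: Re_divide cmod_power2)
  also have "Re z * (Re z - Re b) + Im z * (Im z - Im b)
      = ((cmod (z - b))\<^sup>2 - ((cmod b)\<^sup>2 - 1)) / 2"
    using z unfolding cmod_power2 by (simp add: power2_eq_square algebra_simps)
  finally show ?thesis
    using pos by (simp add: field_simps)
qed

text \<open>With t = |b|, the bound |z - b| \<le> 1 + t makes the Poisson kernel at least (t - 1) /
  (t + 1), which increases with t. The extreme root is b = -kz, opposite to z.\<close>

lemma Re_divide_diff_le:
  assumes "cmod z = 1" "z \<noteq> b" "1 \<le> k" "k \<le> cmod b"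
  shows "Re (z / (z - b)) \<le> 1 / (1 + k)"
proof -
  define t where "t = cmod b"
  have t: "1 \<le> t" "k \<le> t" using assms by (auto simp: t_def)
  have d: "cmod (z - b) \<le> 1 + t" "cmod (z - b) > 0"
    using norm_triangle_ineq4[of z b] assms by (auto simp: t_def)
  have "1 - 2 / (1 + k) \<le> 1 - 2 / (1 + t)"
    using t assms(3) by (simp add: frac_le)
  also have "\<dots> = (t\<^sup>2 - 1) / (1 + t)\<^sup>2"
  proof -
    have "1 + t \<noteq> 0" "t\<^sup>2 - 1 = (t - 1) * (1 + t)"
      using t by (auto simp: power2_eq_square algebra_simps)
    moreover have "1 - 2 / (1 + t) = (t - 1) / (1 + t)"
      using calculation by (simp add: field_simps)
    ultimately show ?thesis by (simp add: power2_eq_square)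
  qed
  also have "\<dots> \<le> (t\<^sup>2 - 1) / (cmod (z - b))\<^sup>2"
    using d t by (intro divide_left_mono power_mono mult_pos_pos) auto
  finally show ?thesis
    using Re_divide_diff[OF assms(1,2)] by (simp add: t_def)
qed

text \<open>\<open>z * q' / q\<close> is the sum of z / (z - b) over the zeros b with multiplicity;
  the induction splits off one linear factor at a time.\<close>

lemma Re_log_deriv_le:
  fixes q :: "complex poly"
  assumes "cmod z = 1" "1 \<le> k" "poly q z \<noteq> 0" "\<And>x. poly q x = 0 \<Longrightarrow> k \<le> cmod x"
  shows "Re (z * poly (pderiv q) z / poly q z) \<le> real (degree q) / (1 + k)"
  using assms(3,4)
proof (induction "degree q" arbitrary: q)
  case 0
  then obtain c where "q = [:c:]" by (metis degree_0_id)
  then show ?case by simp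
next
  case (Suc d)
  obtain b where b: "poly q b = 0"
    using Suc.hyps(2) alg_closed_imp_poly_has_root[of q] by auto
  then obtain q1 where q1: "q = [:- b, 1:] * q1"
    by (metis poly_eq_0_iff_dvd dvdE)
  have nz: "z \<noteq> b" "poly q1 z \<noteq> 0" "q1 \<noteq> 0"
    using Suc.prems(1) b q1 by auto
  have deg: "degree q = Suc (degree q1)"
    unfolding q1 using nz by (subst degree_mult_eq) auto
  have IH: "Re (z * poly (pderiv q1) z / poly q1 z) \<le> real (degree q1) / (1 + k)"
    using Suc.hyps deg nz Suc.prems(2) by (auto simp: q1)
  have "z * poly (pderiv q) z / poly q z = z / (z - b) + z * poly (pderiv q1) z / poly q1 z"
    using nz unfolding q1 pderiv_mult by (simp add: pderiv_pCons field_simps)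
  then have "Re (z * poly (pderiv q) z / poly q z) \<le> 1 / (1 + k) + real (degree q1) / (1 + k)"
    using IH Re_divide_diff_le[OF assms(1) nz(1) assms(2) Suc.prems(2)[OF b]] by simp
  then show ?case
    using deg by (simp add: add_divide_distrib)
qed

lemma poly_pole_poly_0: "poly (pole_poly n a) z = 0 \<longleftrightarrow> (\<exists>j\<in>{1..n}. z = a j)"
  by (auto simp: pole_poly_def poly_prod)

lemma pole_poly_nz: "pole_poly n a \<noteq> 0"
  by (auto simp: pole_poly_def)

lemma degree_pole_poly: "degree (pole_poly n a) = n"
  unfolding pole_poly_def by (subst degree_prod_eq_sum_degree) auto

lemma pole_poly_nonzero_in_disc:
  assumes "\<forall>j\<in>{1..n}. cmod (a j) > 1" "cmod z \<le> 1"
  shows "poly (pole_poly n a) z \<noteq> 0"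
  using assms by (force simp: poly_pole_poly_0)

text \<open>The same decomposition into linear factors, now with the exact value from
  \<open>Re_divide_diff\<close> for each term.\<close>

lemma Re_log_deriv_pole_poly:
  assumes "cmod z = 1" "\<forall>j\<in>{1..n}. cmod (a j) > 1"
  shows "Re (z * poly (pderiv (pole_poly n a)) z / poly (pole_poly n a) z)
           = (real n - poisson_sum n a z) / 2"
  using assms(2)
proof (induction n)
  case 0
  then show ?case by (simp add: pole_poly_def poisson_sum_def)
next
  case (Suc n)
  let ?w = "pole_poly n a" and ?b = "a (Suc n)"
  have nz: "z \<noteq> ?b" "poly ?w z \<noteq> 0"
    using Suc.prems assms(1) by (force, intro pole_poly_nonzero_in_disc) auto
  have w: "pole_poly (Suc n) a = [:- ?b, 1:] * ?w"
    by (simp add: pole_poly_def)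
  have "z * poly (pderiv (pole_poly (Suc n) a)) z / poly (pole_poly (Suc n) a) z
      = z / (z - ?b) + z * poly (pderiv ?w) z / poly ?w z"
    using nz unfolding w pderiv_mult by (simp add: pderiv_pCons field_simps)
  then show ?case
    using Suc Re_divide_diff[OF assms(1) nz(1)]
    by (simp add: poisson_sum_def field_simps)
qed

section \<open>The Blaschke product on the unit circle\<close>

lemma poisson_sum_pos:
  assumes "cmod z = 1" "\<forall>j\<in>{1..n}. cmod (a j) > 1" "n > 0"
  shows "poisson_sum n a z > 0"
  unfolding poisson_sum_def
proof (rule sum_pos)
  fix j assume j: "j \<in> {1..n}"
  then have "cmod (a j) > 1" using assms by auto
  moreover from this have "z \<noteq> a j" using assms(1) by auto
  ultimately show "0 < ((cmod (a j))\<^sup>2 - 1) / (cmod (z - a j))\<^sup>2"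
    by (intro divide_pos_pos) (auto intro: one_less_power)
qed (use assms in auto)

text \<open>Since \<open>z * cnj z = 1\<close>, a numerator 1 - cnj b z equals z times the conjugate
  of z - b. So every factor is unimodular, with logarithmic derivative its Poisson kernel divided by
  z, and these add up under the product rule.\<close>

lemma blaschke_unit_circle:
  assumes "cmod z = 1" "\<forall>j\<in>{1..n}. cmod (a j) > 1"
  shows "cmod (blaschke n a z) = 1 \<and>
    (blaschke n a has_field_derivative of_real (poisson_sum n a z) * blaschke n a z / z) (at z)"
  using assms(2)
proof (induction n)
  case 0
  then show ?case
    by (simp add: blaschke_def [abs_def] poisson_sum_def)
next
  case (Suc n)
  let ?b = "a (Suc n)"
  let ?f = "\<lambda>z. (1 - cnj ?b * z) / (z - ?b)"
  have z: "z \<noteq> 0" "z * cnj z = 1"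
    using assms(1) by (auto simp: complex_norm_square [symmetric])
  have nz: "z \<noteq> ?b"
    using Suc.prems assms(1) by force
  have num: "1 - cnj ?b * z = z * cnj (z - ?b)"
    using z by (simp add: algebra_simps)
  have B: "blaschke (Suc n) a = (\<lambda>z. ?f z * blaschke n a z)"
    by (simp add: blaschke_def fun_eq_iff)
  have f1: "cmod (?f z) = 1"
    unfolding num using nz assms(1) by (simp only: norm_divide norm_mult complex_mod_cnj) simp
  define P where "P = ((cmod ?b)\<^sup>2 - 1) / (cmod (z - ?b))\<^sup>2"
  have "(- cnj ?b * (z - ?b) - (1 - cnj ?b * z)) / (z - ?b)\<^sup>2 = of_real P * ?f z / z"
  proof -
    let ?C = "cnj (z - ?b)"
    have "?C \<noteq> 0" using nz by simp
    have "of_real P = (?b * cnj ?b - 1) / ((z - ?b) * ?C)"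
      unfolding P_def of_real_divide of_real_diff complex_norm_square by simp
    moreover have "- cnj ?b * (z - ?b) - (1 - cnj ?b * z) = ?b * cnj ?b - 1"
      by (simp add: algebra_simps)
    moreover have "u / v\<^sup>2 = u / (v * C) * (z * C / v) / z" if "v \<noteq> 0" "C \<noteq> 0" for u v C :: complex
      using that z(1) by (simp add: power2_eq_square)
    ultimately show ?thesis
      unfolding num using nz \<open>?C \<noteq> 0\<close> by (metis right_minus_eq)
  qed
  moreover have "(?f has_field_derivative
      (- cnj ?b * (z - ?b) - (1 - cnj ?b * z)) / (z - ?b)\<^sup>2) (at z)"
    using nz by (auto intro!: derivative_eq_intros simp: power2_eq_square)
  ultimately have f: "(?f has_field_derivative of_real P * ?f z / z) (at z)" by simp
  have IH: "cmod (blaschke n a z) = 1"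
    "(blaschke n a has_field_derivative of_real (poisson_sum n a z) * blaschke n a z / z) (at z)"
    using Suc by auto
  have "poisson_sum (Suc n) a z = P + poisson_sum n a z"
    by (simp add: poisson_sum_def P_def)
  then have "of_real (poisson_sum (Suc n) a z) * (u * v) / z
      = of_real P * u / z * v + of_real (poisson_sum n a z) * v / z * u" for u v
    using z(1) by (simp add: field_simps)
  then have "((\<lambda>z. ?f z * blaschke n a z) has_field_derivative
      of_real (poisson_sum (Suc n) a z) * (?f z * blaschke n a z) / z) (at z)"
    using DERIV_mult [OF f IH(2)] by (simp only:)
  then show ?case
    using f1 IH(1) unfolding B by (simp only: norm_mult mult_1 simp_thms)
qed

lemma cmod_deriv_blaschke:
  assumes "cmod z = 1" "\<forall>j\<in>{1..n}. cmod (a j) > 1"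
  shows "cmod (deriv (blaschke n a) z) = poisson_sum n a z"
proof -
  have "poisson_sum n a z \<ge> 0"
    using poisson_sum_pos[OF assms] by (cases "n = 0") (auto simp: poisson_sum_def)
  then show ?thesis
    using blaschke_unit_circle[OF assms] assms(1)
    by (auto dest!: DERIV_imp_deriv simp: norm_mult norm_divide)
qed

section \<open>Values and derivatives of \<open>rat_fun\<close> away from zeros of the
  denominator\<close>

lemma poly_analytic_on: "poly (p :: complex poly) analytic_on S"
  by (rule analytic_on_subset[of _ UNIV]) (auto simp: analytic_on_open intro!: holomorphic_intros)

lemma rat_fun_eq:
  assumes "poly q z \<noteq> 0"
  shows "rat_fun p q z = poly p z / poly q z"
proof -
  have "(\<lambda>z. poly p z / poly q z) analytic_on {z}"
    using assms by (intro analytic_on_divide poly_analytic_on) auto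
  then show ?thesis
    unfolding rat_fun_def by (rule remove_sings_at_analytic)
qed

lemma eventually_poly_nz:
  fixes q :: "complex poly"
  assumes "poly q z \<noteq> 0"
  shows "\<forall>\<^sub>F x in nhds z. poly q x \<noteq> 0"
proof -
  have "(poly q \<longlongrightarrow> poly q z) (nhds z)"
    by (intro tendsto_intros filterlim_ident)
  then show ?thesis
    using assms by (rule tendsto_imp_eventually_ne)
qed

lemma deriv_rat_fun:
  assumes "poly q z \<noteq> 0"
  shows "deriv (rat_fun p q) z = quot_deriv p q z"
proof -
  have "\<forall>\<^sub>F x in nhds z. rat_fun p q x = poly p x / poly q x"
    using eventually_poly_nz[OF assms] by eventually_elim (rule rat_fun_eq)
  then have "deriv (rat_fun p q) z = deriv (\<lambda>x. poly p x / poly q x) z"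
    by (rule deriv_cong_ev) simp
  also have "\<dots> = quot_deriv p q z"
    using assms unfolding quot_deriv_def
    by (intro DERIV_imp_deriv) (auto intro!: derivative_eq_intros simp: power2_eq_square)
  finally show ?thesis .
qed

section \<open>From the location of zeros to a comparison of s' with \<beta> s - z s'\<close>

lemma quot_deriv_add_smult:
"quot_deriv (p + smult c w) w z = quot_deriv p w z"
  by (simp add: quot_deriv_def pderiv_add pderiv_smult algebra_simps)

text \<open>\<open>z * s' / s\<close> is the difference of the logarithmic derivatives of
  \<open>q\<close> and \<open>w\<close>, and n / (1 + k) - n / 2 = -n (k - 1) / (2 (k + 1)).\<close>

lemma Re_log_deriv_quot_le:
  assumes "cmod z = 1" "\<forall>j\<in>{1..n}. cmod (a j) > 1" "1 \<le> k"
    and "degree q \<le> n" "poly q z \<noteq> 0" "\<And>x. poly q x = 0 \<Longrightarrow> k \<le> cmod x"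
  defines "w \<equiv> pole_poly n a"
  shows "Re (z * quot_deriv q w z / (poly q z / poly w z))
           \<le> (poisson_sum n a z - real n * (k - 1) / (k + 1)) / 2"
proof -
  have w: "poly w z \<noteq> 0"
    unfolding w_def using assms by (intro pole_poly_nonzero_in_disc) auto
  have "z * quot_deriv q w z / (poly q z / poly w z)
      = z * poly (pderiv q) z / poly q z - z * poly (pderiv w) z / poly w z"
    using w assms(5) by (simp add: quot_deriv_def field_simps power2_eq_square)
  then have "Re (z * quot_deriv q w z / (poly q z / poly w z))
      = Re (z * poly (pderiv q) z / poly q z) - (real n - poisson_sum n a z) / 2"
    using Re_log_deriv_pole_poly[OF assms(1,2)] by (simp only: w_def minus_complex.sel)
  also have "\<dots> \<le> real (degree q) / (1 + k) - (real n - poisson_sum n a z) / 2"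
    using assms(6) by (intro diff_right_mono Re_log_deriv_le[OF assms(1,3,5)])
  also have "\<dots> \<le> real n / (1 + k) - (real n - poisson_sum n a z) / 2"
    using assms(3,4) by (simp add: divide_right_mono)
  also have "\<dots> = (poisson_sum n a z - real n * (k - 1) / (k + 1)) / 2"
    using assms(3) by (simp add: field_simps)
  finally show ?thesis .
qed

text \<open>With u = z d / s, the gap |\<beta> - u|^2 - |u|^2 is \<beta> (\<beta> - 2 Re u), at
  least \<beta> c by the bound on Re u. The second claim holds because u = \<beta> would violate
  that bound when \<beta> > 0; it later excludes particular values of |T|.\<close>

lemma poisson_sum_diff_ineq:
  assumes "cmod z = 1" "\<forall>j\<in>{1..n}. cmod (a j) > 1" "1 \<le> k"
    and "degree q \<le> n" "\<And>x. poly q x = 0 \<Longrightarrow> k \<le> cmod x"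
  defines "w \<equiv> pole_poly n a"
  defines "s \<equiv> poly q z / poly w z"
  defines "d \<equiv> quot_deriv q w z"
  defines "\<beta> \<equiv> poisson_sum n a z"
  shows "(cmod d)\<^sup>2 + \<beta> * (real n * (k - 1) / (k + 1)) * (cmod s)\<^sup>2 \<le> (cmod (of_real \<beta> * s - z * d))\<^sup>2"
    and "0 < n \<Longrightarrow> s \<noteq> 0 \<Longrightarrow> of_real \<beta> * s - z * d \<noteq> 0"
proof -
  have w: "poly w z \<noteq> 0"
    unfolding w_def using assms by (intro pole_poly_nonzero_in_disc) auto
  have \<beta>: "\<beta> \<ge> 0"
    unfolding \<beta>_def using poisson_sum_pos[OF assms(1,2)] by (cases "n = 0") (auto simp: poisson_sum_def)
  define c where "c = real n * (k - 1) / (k + 1)"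
  have c: "c \<ge> 0" using assms(3) by (simp add: c_def)
  have re: "Re (z * d / s) \<le> (\<beta> - c) / 2" if "s \<noteq> 0"
    using Re_log_deriv_quot_le[OF assms(1-4) _ assms(5)] that
    by (auto simp: s_def d_def w_def \<beta>_def c_def)
  show "of_real \<beta> * s - z * d \<noteq> 0" if "0 < n" "s \<noteq> 0"
  proof
    assume "of_real \<beta> * s - z * d = 0"
    then have "z * d / s = of_real \<beta>" using that by (simp add: field_simps)
    then have "\<beta> \<le> (\<beta> - c) / 2" using re[OF that(2)] by simp
    moreover have "\<beta> > 0" using poisson_sum_pos[OF assms(1,2) that(1)] by (simp add: \<beta>_def)
    ultimately show False using c by simp
  qed
  show "(cmod d)\<^sup>2 + \<beta> * (real n * (k - 1) / (k + 1)) * (cmod s)\<^sup>2 \<le> (cmod (of_real \<beta> * s - z * d))\<^sup>2"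
  proof (cases "s = 0")
    case True
    then show ?thesis using assms(1) by (simp add: norm_mult)
  next
    case False
    define u where "u = z * d / s"
    have d: "cmod d = cmod u * cmod s"
      using False assms(1) by (simp add: u_def norm_mult norm_divide)
    have "of_real \<beta> * s - z * d = (of_real \<beta> - u) * s"
      using False by (simp add: u_def field_simps)
    then have "(cmod (of_real \<beta> * s - z * d))\<^sup>2 = (cmod (of_real \<beta> - u))\<^sup>2 * (cmod s)\<^sup>2"
      by (simp add: norm_mult power_mult_distrib)
    also have "(cmod (of_real \<beta> - u))\<^sup>2 = (cmod u)\<^sup>2 + \<beta> * (\<beta> - 2 * Re u)"
      unfolding cmod_power2 by (simp add: power2_eq_square algebra_simps)
    finally have eq: "(cmod (of_real \<beta> * s - z * d))\<^sup>2 = ((cmod u)\<^sup>2 + \<beta> * (\<beta> - 2 * Re u)) * (cmod s)\<^sup>2" .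
    have "\<beta> * c \<le> \<beta> * (\<beta> - 2 * Re u)"
      using re[OF False] \<beta> by (intro mult_left_mono) (auto simp: u_def)
    then have "((cmod u)\<^sup>2 + \<beta> * c) * (cmod s)\<^sup>2 \<le> ((cmod u)\<^sup>2 + \<beta> * (\<beta> - 2 * Re u)) * (cmod s)\<^sup>2"
      by (intro mult_right_mono) auto
    then show ?thesis
      unfolding eq d by (simp add: power_mult_distrib algebra_simps c_def)
  qed
qed

section \<open>Maximum principle, and the bounds supplied by \<open>circle_min\<close> and
  \<open>circle_norm\<close>\<close>

lemma poly_quotient_max_modulus:
  fixes p q :: "complex poly"
  assumes "0 < R" "\<And>x. cmod x \<le> R \<Longrightarrow> poly q x \<noteq> 0"
    and "\<And>x. cmod x = R \<Longrightarrow> cmod (poly p x / poly q x) \<le> M" "cmod z \<le> R"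
  shows "cmod (poly p z / poly q z) \<le> M"
proof (rule maximum_modulus_frontier[where f = "\<lambda>x. poly p x / poly q x" and S = "cball 0 R" and \<xi> = z])
  show "(\<lambda>x. poly p x / poly q x) holomorphic_on interior (cball 0 R)"
    using assms(2) by (auto intro!: holomorphic_intros)
  show "continuous_on (closure (cball 0 R)) (\<lambda>x. poly p x / poly q x)"
    using assms(2) by (auto intro!: continuous_intros)
qed (use assms in auto)

text \<open>A zero of \<open>p\<close> on the circle itself is also a zero of \<open>w\<close> and can be cancelled.\<close>

lemma dominated_on_disc:
  fixes p w :: "complex poly"
  assumes "0 < R" "0 < m" "p \<noteq> 0" "\<And>x. poly p x = 0 \<Longrightarrow> R \<le> cmod x"
    and "\<And>x. cmod x = R \<Longrightarrow> m * cmod (poly w x) \<le> cmod (poly p x)" "cmod z \<le> R"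
  shows "m * cmod (poly w z) \<le> cmod (poly p z)"
  using assms(3-6)
proof (induction "degree p" arbitrary: p w rule: less_induct)
  case less
  show ?case
  proof (cases "\<exists>b. cmod b = R \<and> poly p b = 0")
    case False
    have nz: "poly p x \<noteq> 0" if "cmod x \<le> R" for x
      using that False less.prems(2)[of x] by force
    \<comment> \<open>With \<open>p\<close> free of zeros in the closed disc, the maximum principle
      applies to the inverted quotient w / p.\<close>
    have "cmod (poly w z / poly p z) \<le> 1 / m"
    proof (rule poly_quotient_max_modulus[OF assms(1) nz])
      fix x assume "cmod x = R"
      then show "cmod (poly w x / poly p x) \<le> 1 / m"
        using less.prems(3)[of x] nz[of x] assms(2) by (simp add: norm_divide field_simps)
    qed (use less.prems in auto)
    then show ?thesis
      using nz[OF less.prems(4)] assms(2) by (simp add: norm_divide field_simps)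
  next
    case True
    then obtain b where b: "cmod b = R" "poly p b = 0" by blast
    then have "poly w b = 0"
      using less.prems(3)[of b] assms(2) by (simp add: mult_le_0_iff)
    then obtain p1 w1 where p1: "p = [:- b, 1:] * p1" and w1: "w = [:- b, 1:] * w1"
      using b(2) by (metis poly_eq_0_iff_dvd dvdE)
    have nz: "p1 \<noteq> 0" using less.prems(1) p1 by auto
    have "m * cmod (poly w1 z) \<le> cmod (poly p1 z)"
    proof (rule less.hyps)
      show "degree p1 < degree p"
        unfolding p1 using nz by (subst degree_mult_eq) auto
      show "R \<le> cmod x" if "poly p1 x = 0" for x
        using that less.prems(2)[of x] by (simp add: p1)
      fix x assume x: "cmod x = R"
      have off: "m * cmod (poly w1 y) \<le> cmod (poly p1 y)" if "cmod y = R" "y \<noteq> b" for y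
      proof -
        have lin: "poly ([:- b, 1:] * u) y = (y - b) * poly u y" for u
          by (simp add: algebra_simps)
        have "cmod (y - b) * (m * cmod (poly w1 y)) \<le> cmod (y - b) * cmod (poly p1 y)"
          using less.prems(3)[OF that(1)] unfolding p1 w1 lin norm_mult by (simp add: mult.left_commute)
        then show ?thesis using that(2) by simp
      qed
      show "m * cmod (poly w1 x) \<le> cmod (poly p1 x)"
      proof (cases "x = b")
        case True
        \<comment> \<open>Cancelling |y - b| gives the inequality only away from b. At b it follows
          by continuity along the arc e(t), which stays on the circle and avoids b for 0 < t <
          pi.\<close>
        define e where "e = (\<lambda>t::real. b * cis t)"
        have lim: "(e \<longlongrightarrow> b) (at_right 0)"
          unfolding e_def by (auto intro!: tendsto_eq_intros simp: cis_conv_exp)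
        have ev: "\<forall>\<^sub>F t in at_right 0. m * cmod (poly w1 (e t)) \<le> cmod (poly p1 (e t))"
        proof (rule eventually_at_rightI[of 0 pi])
          fix t :: real assume t: "t \<in> {0<..<pi}"
          then have "cis t \<noteq> 1" using sin_gt_zero[of t] by (auto simp: complex_eq_iff)
          then have "e t \<noteq> b" using b assms(1) by (auto simp: e_def)
          then show "m * cmod (poly w1 (e t)) \<le> cmod (poly p1 (e t))"
            using b by (intro off) (auto simp: e_def norm_mult)
        qed simp
        have "m * cmod (poly w1 b) \<le> cmod (poly p1 b)"
          by (rule tendsto_le[OF _ _ _ ev]) (auto intro!: tendsto_intros lim)
        then show ?thesis using True by simp
      qed (use off x in auto)
    qed (use nz less.prems in auto)
    then have "cmod (z - b) * (m * cmod (poly w1 z)) \<le> cmod (z - b) * cmod (poly p1 z)"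
      by (intro mult_left_mono) auto
    moreover have "poly ([:- b, 1:] * u) z = (z - b) * poly u z" for u
      by (simp add: algebra_simps)
    ultimately show ?thesis
      unfolding p1 w1 by (simp only: norm_mult) (simp add: mult.left_commute)
  qed
qed

text \<open>The product form also covers zeros of \<open>q\<close>, where the left side vanishes.
  Elsewhere \<open>rat_fun\<close> has a finite limit, so \<open>ext_cmod\<close> is the finite
  modulus of the quotient and the infimum is finite too.\<close>

lemma circle_min_bounds:
  fixes p q :: "complex poly"
  assumes "0 < k" "q \<noteq> 0"
  shows "0 \<le> circle_min k (rat_fun p q)"
    and "cmod z = k \<Longrightarrow> circle_min k (rat_fun p q) * cmod (poly q z) \<le> cmod (poly p z)"
proof -
  let ?I = "INF z\<in>sphere 0 k. ext_cmod (rat_fun p q) z"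
  have I0: "0 \<le> ?I" by (intro INF_greatest) (auto simp: ext_cmod_def)
  then show "0 \<le> circle_min k (rat_fun p q)"
    unfolding circle_min_def by (simp add: real_of_ereal_pos)
  assume z: "cmod z = k"
  show "circle_min k (rat_fun p q) * cmod (poly q z) \<le> cmod (poly p z)"
  proof (cases "poly q z = 0")
    case False
    have "rat_fun p q \<midarrow>z\<rightarrow> poly p z / poly q z"
    proof (rule Lim_transform_eventually)
      show "(\<lambda>x. poly p x / poly q x) \<midarrow>z\<rightarrow> poly p z / poly q z"
        using False by (auto intro!: tendsto_intros)
      show "\<forall>\<^sub>F x in at z. poly p x / poly q x = rat_fun p q x"
        using eventually_nhds_conv_at[THEN iffD1, OF eventually_poly_nz[OF False]]
        by (auto elim!: eventually_mono simp: rat_fun_eq)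
    qed
    then have np: "\<not> is_pole (rat_fun p q) z"
      unfolding is_pole_def using not_tendsto_and_filterlim_at_infinity[of "at z"] by auto
    have "?I \<le> ext_cmod (rat_fun p q) z"
      using z by (intro INF_lower) auto
    then have "?I \<le> ereal (cmod (poly p z / poly q z))"
      using np False by (simp add: ext_cmod_def rat_fun_eq)
    then have "real_of_ereal ?I \<le> cmod (poly p z / poly q z)"
      using I0 by (cases ?I) auto
    then show ?thesis
      unfolding circle_min_def using False by (simp add: norm_divide field_simps)
  qed simp
qed

lemma cmod_rat_fun_le_circle_norm:
  assumes "\<And>x. cmod x = 1 \<Longrightarrow> poly q x \<noteq> 0" "cmod z = 1"
  shows "cmod (poly p z / poly q z) \<le> circle_norm (rat_fun p q)"
proof -
  have eq: "circle_norm (rat_fun p q) = (SUP x\<in>sphere 0 1. cmod (poly p x / poly q x))"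
    unfolding circle_norm_def using assms(1) by (intro SUP_cong) (auto simp: rat_fun_eq)
  have "continuous_on (sphere 0 1) (\<lambda>x. cmod (poly p x / poly q x))"
    using assms(1) by (auto intro!: continuous_intros)
  then have "bdd_above ((\<lambda>x. cmod (poly p x / poly q x)) ` sphere 0 1)"
    by (intro bounded_imp_bdd_above compact_imp_bounded compact_continuous_image) auto
  then show ?thesis
    unfolding eq using assms(2) by (intro cSUP_upper) auto
qed

section \<open>The derivative estimate by perturbation with constants\<close>

text \<open>M and m enter only through one-sided bounds, so the argument needs neither attained
  extrema nor a treatment of poles on |x| = k.\<close>

lemma quot_deriv_bound:
  assumes z: "cmod z = 1" and a: "\<forall>j\<in>{1..n}. cmod (a j) > 1" and k: "1 \<le> k" and n: "0 < n"
    and p: "degree p \<le> n" "p \<noteq> 0" "\<And>x. poly p x = 0 \<Longrightarrow> k \<le> cmod x"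
  defines "w \<equiv> pole_poly n a"
  assumes M: "\<And>x. cmod x = 1 \<Longrightarrow> cmod (poly p x / poly w x) \<le> M"
    and m: "0 \<le> m" "\<And>x. cmod x = k \<Longrightarrow> m * cmod (poly w x) \<le> cmod (poly p x)"
  shows "cmod (quot_deriv p w z) \<le> 1 / 2 * (poisson_sum n a z
    - real n * (k - 1) * (cmod (poly p z / poly w z) - m)\<^sup>2 / ((k + 1) * (M - m)\<^sup>2)) * (M - m)"
proof -
  define \<beta> where "\<beta> = poisson_sum n a z"
  define c where "c = real n * (k - 1) / (k + 1)"
  define s where "s = poly p z / poly w z"
  define d where "d = quot_deriv p w z"
  define T where "T = of_real \<beta> * s - z * d"
  \<comment> \<open>The direction of T, or any unit number if T = 0: replacing s by s - l u moves T
    radially to (|T| - \<beta> l) u.\<close>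
  define u where "u = (if T = 0 then 1 else sgn T)"
  have u: "cmod u = 1" "T = of_real (cmod T) * u"
    by (auto simp: u_def sgn_eq norm_divide)
  have \<beta>: "\<beta> > 0"
    unfolding \<beta>_def by (rule poisson_sum_pos[OF z a n])
  have w: "poly w x \<noteq> 0" if "cmod x \<le> 1" for x
    unfolding w_def using a that by (rule pole_poly_nonzero_in_disc)
  have wz: "poly w z \<noteq> 0" using w z by simp
  \<comment> \<open>The unit circle lies in the disc of radius k, so the lower bound on |x| = k
    carries over to z by the maximum principle.\<close>
  have s_ge: "m \<le> cmod s"
  proof (cases "m = 0")
    case False
    then have "m * cmod (poly w z) \<le> cmod (poly p z)"
      using m(1) k z by (intro dominated_on_disc[OF _ _ p(2,3) m(2)]) auto
    then show ?thesis using wz by (simp add: s_def norm_divide field_simps)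
  qed simp

  \<comment> \<open>The radius \<kappa> will be 1 for l above M, which removes the middle term, and
    k for l below m.\<close>
  have perturb: "(cmod d)\<^sup>2 + \<beta> * (real n * (\<kappa> - 1) / (\<kappa> + 1)) * (cmod (s - of_real l * u))\<^sup>2
        \<le> (cmod T - \<beta> * l)\<^sup>2"
      "s - of_real l * u \<noteq> 0 \<Longrightarrow> cmod T \<noteq> \<beta> * l"
    if \<kappa>: "1 \<le> \<kappa>" "\<And>x. poly p x = of_real l * u * poly w x \<Longrightarrow> \<kappa> \<le> cmod x" for l \<kappa>
  proof -
    define q where "q = p + smult (- of_real l * u) w"
    have deg: "degree q \<le> n"
      unfolding q_def using p degree_pole_poly[of n a]
      by (intro degree_add_le) (auto intro: order.trans[OF degree_smult_le] simp: w_def)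
    have zeros: "\<kappa> \<le> cmod x" if "poly q x = 0" for x
      using \<kappa>(2)[of x] that by (simp add: q_def)
    have q: "poly q z / poly w z = s - of_real l * u" "quot_deriv q w z = d"
      unfolding q_def d_def quot_deriv_add_smult using wz by (simp_all add: s_def diff_divide_distrib)
    have "of_real \<beta> * (s - of_real l * u) - z * d = of_real (cmod T) * u - of_real \<beta> * of_real l * u"
      unfolding u(2)[symmetric] by (simp add: T_def algebra_simps)
    also have "\<dots> = of_real (cmod T - \<beta> * l) * u"
      by (simp add: algebra_simps)
    finally have T: "of_real \<beta> * (s - of_real l * u) - z * d = of_real (cmod T - \<beta> * l) * u" .
    have nT: "(cmod (of_real (cmod T - \<beta> * l) * u))\<^sup>2 = (cmod T - \<beta> * l)\<^sup>2"
      by (simp only: norm_mult u(1) norm_of_real mult_1_right power2_abs)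
    show "(cmod d)\<^sup>2 + \<beta> * (real n * (\<kappa> - 1) / (\<kappa> + 1)) * (cmod (s - of_real l * u))\<^sup>2
        \<le> (cmod T - \<beta> * l)\<^sup>2"
      using poisson_sum_diff_ineq(1)[OF z a \<kappa>(1) deg zeros]
      by (simp only: w_def[symmetric] \<beta>_def[symmetric] q T nT)
    show "cmod T \<noteq> \<beta> * l" if "s - of_real l * u \<noteq> 0"
      using poisson_sum_diff_ineq(2)[OF z a \<kappa>(1) deg zeros n]  that
      by (simp only: w_def[symmetric] \<beta>_def[symmetric] q T) auto
  qed

  have upper: "cmod d \<le> \<bar>cmod T - \<beta> * L\<bar>" "cmod T \<noteq> \<beta> * L" if L: "M < L" for L
  proof -
    have M0: "0 \<le> M" using M[OF z] norm_ge_zero order.trans by blast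
    have zeros: "1 \<le> cmod x" if "poly p x = of_real L * u * poly w x" for x
    proof (rule ccontr)
      assume "\<not> 1 \<le> cmod x"
      then have "cmod (poly p x / poly w x) \<le> M"
        using poly_quotient_max_modulus[OF zero_less_one w M] by simp
      moreover have "poly p x / poly w x = of_real L * u"
        using that w \<open>\<not> 1 \<le> cmod x\<close> by simp
      ultimately show False using L M0 u(1) by (simp add: norm_mult)
    qed
    have "(cmod d)\<^sup>2 \<le> (cmod T - \<beta> * L)\<^sup>2"
      using perturb(1)[where l = L, OF order.refl zeros] by simp
    then show "cmod d \<le> \<bar>cmod T - \<beta> * L\<bar>"
      using abs_le_square_iff[of "cmod d"] by simp
    have "s \<noteq> of_real L * u"
      using M[OF z] L M0 u(1) by (auto simp: s_def[symmetric] norm_mult)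
    then show "cmod T \<noteq> \<beta> * L"
      using perturb(2)[where l = L, OF order.refl zeros] by simp
  qed
  \<comment> \<open>Otherwise L = |T| / \<beta> exceeds M and attains the excluded equality. This
    settles the sign inside the absolute value of \<open>upper\<close>; L then decreases to
    M.\<close>
  have T_le: "cmod T \<le> \<beta> * M"
  proof (rule ccontr)
    assume "\<not> cmod T \<le> \<beta> * M"
    then have "M < cmod T / \<beta>" using \<beta> by (simp add: field_simps)
    then show False using upper(2)[of "cmod T / \<beta>"] \<beta> by simp
  qed
  have "(cmod d + cmod T) / \<beta> \<le> M"
  proof (rule dense_ge)
    fix L assume L: "M < L"
    then have "\<beta> * M \<le> \<beta> * L" using \<beta> by simp
    then have "cmod d + cmod T \<le> \<beta> * L" using upper(1)[OF L] T_le by simp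
    then show "(cmod d + cmod T) / \<beta> \<le> L" using \<beta> by (simp add: field_simps)
  qed
  then have sum_le: "cmod d + cmod T \<le> \<beta> * M" using \<beta> by (simp add: field_simps)

  \<comment> \<open>The alternative l = 0 handles m = 0. A zero x of p - l u w with |x| < k would,
    for 0 < l < m, give m |w(x)| \<le> |p(x)| = l |w(x)|, hence w(x) = p(x) = 0, although p has no
    zero there.\<close>
  have lower: "(cmod d)\<^sup>2 + \<beta> * c * (cmod s - l)\<^sup>2 \<le> (cmod T - \<beta> * l)\<^sup>2"
      "l < m \<Longrightarrow> cmod T \<noteq> \<beta> * l"
    if l: "0 \<le> l" "l < m \<or> l = 0" for l
  proof -
    have zeros: "k \<le> cmod x" if x: "poly p x = of_real l * u * poly w x" for x
    proof (rule ccontr)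
      assume less: "\<not> k \<le> cmod x"
      then have px: "poly p x \<noteq> 0" using p by blast
      then have "l \<noteq> 0" using x by auto
      then have "l < m" using l by auto
      have "m * cmod (poly w x) \<le> cmod (poly p x)"
        using k less l(1) \<open>l < m\<close> by (intro dominated_on_disc[OF _ _ p(2,3) m(2)]) auto
      also have "\<dots> = l * cmod (poly w x)" using x u(1) l by (simp add: norm_mult)
      finally have "poly w x = 0" using \<open>l < m\<close> by (simp add: mult_le_cancel_right)
      then show False using x px by simp
    qed
    have "l \<le> cmod s" using l s_ge m by auto
    moreover have "cmod s - l \<le> cmod (s - of_real l * u)"
      using norm_triangle_ineq2[of s "of_real l * u"] l u(1) by (simp add: norm_mult)
    ultimately have "(cmod s - l)\<^sup>2 \<le> (cmod (s - of_real l * u))\<^sup>2"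
      by (intro power_mono) auto
    then have "\<beta> * c * (cmod s - l)\<^sup>2 \<le> \<beta> * c * (cmod (s - of_real l * u))\<^sup>2"
      using \<beta> k by (intro mult_left_mono) (auto simp: c_def)
    then show "(cmod d)\<^sup>2 + \<beta> * c * (cmod s - l)\<^sup>2 \<le> (cmod T - \<beta> * l)\<^sup>2"
      using perturb(1)[where l = l, OF k zeros] unfolding c_def by linarith
    show "cmod T \<noteq> \<beta> * l" if "l < m"
    proof -
      have "s \<noteq> of_real l * u" using that s_ge l u(1) by (auto simp: norm_mult)
      then show ?thesis using perturb(2)[where l = l, OF k zeros] by simp
    qed
  qed
  \<comment> \<open>Again l = |T| / \<beta> would attain an excluded equality. Nonnegativity of |T|
    - \<beta> m is what permits squaring the upper bound on it below.\<close>
  have T_ge: "\<beta> * m \<le> cmod T"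
  proof (rule ccontr)
    assume "\<not> \<beta> * m \<le> cmod T"
    then have "cmod T / \<beta> < m" using \<beta> by (simp add: field_simps)
    then show False using lower(2)[of "cmod T / \<beta>"] \<beta> by simp
  qed
  have at_m: "(cmod d)\<^sup>2 + \<beta> * c * (cmod s - m)\<^sup>2 \<le> (cmod T - \<beta> * m)\<^sup>2"
  proof (cases "m = 0")
    case True
    then show ?thesis using lower(1)[of 0] by simp
  next
    case False
    \<comment> \<open>The zero location is established for l < m only, so the value m is reached as
      a limit from the left.\<close>
    have "\<forall>\<^sub>F l in at_left m. (cmod d)\<^sup>2 + \<beta> * c * (cmod s - l)\<^sup>2 \<le> (cmod T - \<beta> * l)\<^sup>2"
      by (rule eventually_at_leftI[of 0]) (use lower(1) m False in auto)
    then show ?thesis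
      by (rule tendsto_le[rotated -1]) (auto intro!: tendsto_intros)
  qed

  define D where "D = M - m"
  define X where "X = \<beta> * c * (cmod s - m)\<^sup>2"
  have "X \<ge> 0" using \<beta> k by (simp add: X_def c_def)
  have dD: "cmod T - \<beta> * m \<le> \<beta> * D - cmod d"
    using sum_le by (simp add: D_def algebra_simps)
  then have "(cmod T - \<beta> * m)\<^sup>2 \<le> (\<beta> * D - cmod d)\<^sup>2"
    using T_ge by (intro power_mono) auto
  then have "(cmod d)\<^sup>2 + X \<le> (\<beta> * D - cmod d)\<^sup>2"
    using at_m by (simp add: X_def)
  \<comment> \<open>Expanding the square cancels |d|^2 and leaves the common positive factor
    \<beta>.\<close>
  then have "\<beta> * (c * (cmod s - m)\<^sup>2) \<le> \<beta> * (\<beta> * D\<^sup>2 - 2 * D * cmod d)"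
    by (simp add: X_def power2_eq_square algebra_simps)
  then have main: "c * (cmod s - m)\<^sup>2 \<le> \<beta> * D\<^sup>2 - 2 * D * cmod d"
    using \<beta> by simp
  have D0: "D \<ge> 0" "cmod d \<le> \<beta> * D"
  proof -
    show "cmod d \<le> \<beta> * D" using dD T_ge by simp
    then have "0 \<le> \<beta> * D" using norm_ge_zero order.trans by blast
    then show "D \<ge> 0" using \<beta> by (simp add: zero_le_mult_iff)
  qed
  have "cmod d \<le> 1 / 2 * (\<beta> - c * (cmod s - m)\<^sup>2 / D\<^sup>2) * D"
  proof (cases "D = 0")
    \<comment> \<open>Division by zero is harmless here: the factor D makes the right side 0, and
      |d| \<le> \<beta> D forces d = 0.\<close>
    case True
    then show ?thesis using D0 by simp
  next
    case False
    have "2 * D * cmod d \<le> \<beta> * D\<^sup>2 - c * (cmod s - m)\<^sup>2" using main by simp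
    then have "cmod d \<le> (\<beta> * D\<^sup>2 - c * (cmod s - m)\<^sup>2) / (2 * D)"
      using False D0(1) by (simp add: pos_le_divide_eq mult_ac)
    also have "\<dots> = 1 / 2 * (\<beta> - c * (cmod s - m)\<^sup>2 / D\<^sup>2) * D"
      using False by (simp add: diff_divide_distrib left_diff_distrib power2_eq_square)
    finally show ?thesis .
  qed
  also have "c * (cmod s - m)\<^sup>2 / D\<^sup>2 = real n * (k - 1) * (cmod s - m)\<^sup>2 / ((k + 1) * D\<^sup>2)"
    by (simp add: c_def)
  finally show ?thesis
    by (simp add: \<beta>_def s_def d_def D_def)
qed

lemma deriv_rat_fun_bound:
  assumes k: "1 \<le> k" and a: "\<forall>j\<in>{1..n}. cmod (a j) > 1" and p: "degree p = n"
    "\<And>x. poly p x = 0 \<Longrightarrow> k \<le> cmod x" and z: "cmod z = 1"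
  defines "r \<equiv> rat_fun p (pole_poly n a)"
  defines "m \<equiv> circle_min k r"
  shows "cmod (deriv r z) \<le> 1 / 2 * (cmod (deriv (blaschke n a) z)
    - real n * (k - 1) * (cmod (r z) - m)\<^sup>2 / ((k + 1) * (circle_norm r - m)\<^sup>2)) * (circle_norm r - m)"
proof (cases "n = 0")
  \<comment> \<open>For n = 0 the Poisson sum vanishes and \<beta> cannot be divided out, but r is
    constant and both sides are 0.\<close>
  case True
  then have "pderiv p = 0" using p by (simp add: pderiv_eq_0_iff)
  then have "deriv r z = 0"
    unfolding r_def using True
    by (subst deriv_rat_fun) (simp_all add: pole_poly_def quot_deriv_def)
  then show ?thesis
    using True cmod_deriv_blaschke[OF z a] by (simp add: poisson_sum_def)
next
  case False
  let ?w = "pole_poly n a"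
  have w: "poly ?w x \<noteq> 0" if "cmod x = 1" for x
    using a that by (intro pole_poly_nonzero_in_disc) auto
  have "cmod (quot_deriv p ?w z) \<le> 1 / 2 * (poisson_sum n a z
    - real n * (k - 1) * (cmod (poly p z / poly ?w z) - m)\<^sup>2 / ((k + 1) * (circle_norm r - m)\<^sup>2))
      * (circle_norm r - m)"
    using k p False cmod_rat_fun_le_circle_norm[OF w, of _ p]
      circle_min_bounds[where p = p, OF _ pole_poly_nz[of n a], of k]
    by (intro quot_deriv_bound[OF z a k]) (auto simp: r_def m_def)
  then show ?thesis
    using w[OF z] cmod_deriv_blaschke[OF z a]
    by (simp add: r_def deriv_rat_fun rat_fun_eq)
qed

section \<open>The equality case\<close>

lemma extremal_rat_fun:
  fixes n :: nat and k a :: real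
  assumes "1 \<le> k" "1 < a"
  shows "rat_fun ([:of_real k, 1:] ^ n) (pole_poly n (\<lambda>_. of_real a))
           = (\<lambda>z. ((z + of_real k) / (z - of_real a)) ^ n)"
proof
  fix z :: complex
  let ?p = "[:of_real k, 1:] ^ n" and ?w = "pole_poly n (\<lambda>_. of_real a)"
  have p: "poly ?p x = (x + of_real k) ^ n" for x :: complex
    by (simp add: add.commute)
  have w: "poly ?w x = (x - of_real a) ^ n" for x
    by (simp add: pole_poly_def)
  show "rat_fun ?p ?w z = ((z + of_real k) / (z - of_real a)) ^ n"
  proof (cases "poly ?w z = 0")
    case False
    then have "rat_fun ?p ?w z = poly ?p z / poly ?w z" by (rule rat_fun_eq)
    then show ?thesis by (simp only: p w power_divide)
  next
    \<comment> \<open>At the pole a the two default values agree: \<open>remove_sings\<close> gives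
      0, and so does the positive power of a division by zero. The pole is genuine because a + k >
      0.\<close>
    case True
    then have z: "z = of_real a" "n > 0" by (auto simp: w)
    have "is_pole (\<lambda>x. poly ?p x / poly ?w x) z"
    proof (rule is_pole_divide)
      show "poly ?p z \<noteq> 0"
        using assms z by (simp add: p flip: of_real_add)
      show "filterlim (poly ?w) (at 0) (at z)"
      proof -
        have "poly ?w \<midarrow>z\<rightarrow> poly ?w z" by (intro tendsto_intros)
        then have "poly ?w \<midarrow>z\<rightarrow> 0" using True by simp
        then show ?thesis
          by (auto simp: filterlim_at w z eventually_at_filter)
      qed
    qed simp
    then have "rat_fun ?p ?w z = 0"
      unfolding rat_fun_def by (rule remove_sings_at_pole)
    then show ?thesis using z by simp
  qed
qed

text \<open>At z = 1 the numerator has its largest modulus and the denominator its smallest.\<close>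

lemma extremal_circle_norm:
  fixes n :: nat and k a :: real
  assumes "1 \<le> k" "1 < a"
  shows "circle_norm (\<lambda>z. ((z + of_real k) / (z - of_real a)) ^ n) = ((1 + k) / (a - 1)) ^ n"
  unfolding circle_norm_def
proof (rule cSup_eq_maximum)
  have "cmod (1 + of_real k) = 1 + k" "cmod (1 - of_real a) = a - 1"
    using assms norm_of_real[of "1 + k", where 'a = complex] norm_of_real[of "1 - a", where 'a = complex]
    by simp_all
  then have "((1 + k) / (a - 1)) ^ n = cmod (((1 + of_real k) / (1 - of_real a)) ^ n)"
    by (simp add: norm_power norm_divide)
  then show "((1 + k) / (a - 1)) ^ n
      \<in> (\<lambda>z. cmod (((z + of_real k) / (z - of_real a)) ^ n)) ` sphere 0 1"
    by (intro image_eqI[of _ _ 1]) auto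
next
  fix y assume "y \<in> (\<lambda>z. cmod (((z + of_real k) / (z - of_real a)) ^ n)) ` sphere 0 1"
  then obtain z where z: "cmod z = 1" "y = (cmod (z + of_real k) / cmod (z - of_real a)) ^ n"
    by (auto simp: norm_power norm_divide)
  have "cmod (z + of_real k) \<le> 1 + k"
    using norm_triangle_ineq[of z "of_real k"] z assms by simp
  moreover have "a - 1 \<le> cmod (z - of_real a)"
    using norm_triangle_ineq2[of "of_real a" z] z assms by (simp add: norm_minus_commute)
  ultimately show "y \<le> ((1 + k) / (a - 1)) ^ n"
    unfolding z(2) using assms by (intro power_mono frac_le) auto
qed

text \<open>Here m = 0 and |r(1)| is the norm of r, so the quotient of squares is 1 and only an
  identity between explicit numbers remains.\<close>

lemma extremal_equality:
  fixes n :: nat and k a :: real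
  assumes "1 \<le> k" "1 < a"
  defines "r \<equiv> (\<lambda>z. ((z + of_real k) / (z - of_real a)) ^ n)"
  defines "m \<equiv> circle_min k r"
  shows "cmod (deriv r 1) = 1 / 2 * (cmod (deriv (blaschke n (\<lambda>_. of_real a)) 1)
    - real n * (k - 1) * (cmod (r 1) - m)\<^sup>2 / ((k + 1) * (circle_norm r - m)\<^sup>2)) * (circle_norm r - m)"
proof (cases n)
  case 0
  then show ?thesis by (simp add: r_def blaschke_def [abs_def])
next
  case (Suc j)
  have abs: "cmod (1 + of_real k) = 1 + k" "cmod (1 - of_real a) = a - 1"
    using assms norm_of_real[of "1 + k", where 'a = complex] norm_of_real[of "1 - a", where 'a = complex]
    by simp_all
  have a1: "complex_of_real a \<noteq> 1" using assms(2) by (metis less_irrefl of_real_eq_1_iff)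
  \<comment> \<open>The zero -k of r lies on |z| = k and is not a pole, which forces m = 0.\<close>
  have "cmod (of_real (- k)) = k" using assms(1) by simp
  then have "m * cmod (poly (pole_poly n (\<lambda>_. of_real a)) (of_real (- k)))
      \<le> cmod (poly ([:of_real k, 1:] ^ n) (of_real (- k)))" "m \<ge> 0"
    unfolding m_def r_def extremal_rat_fun[OF assms(1,2), symmetric]
    using assms(1) by (intro circle_min_bounds pole_poly_nz; simp)+
  moreover have "poly (pole_poly n (\<lambda>_. complex_of_real a)) (of_real (- k)) \<noteq> 0"
    using assms(1,2) by (simp only: poly_pole_poly_0 of_real_eq_iff) auto
  ultimately have m: "m = 0" using Suc by (simp add: mult_le_0_iff)
  define N where "N = (1 + k) / (a - 1)"
  have "(r has_field_derivative
      of_nat n * ((1 + of_real k) / (1 - of_real a)) ^ j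
      * (of_real (- (a + k)) / (1 - of_real a)\<^sup>2)) (at 1)"
  proof -
    have "((\<lambda>z. (z + of_real k) / (z - of_real a)) has_field_derivative
        of_real (- (a + k)) / (1 - of_real a)\<^sup>2) (at 1)"
      using a1 by (auto intro!: derivative_eq_intros simp: power2_eq_square)
    from DERIV_power[OF this, of n] show ?thesis
      by (simp add: r_def Suc mult_ac)
  qed
  then have "cmod (deriv r 1) = real n * N ^ j * (cmod (of_real (- (a + k))) / (a - 1)\<^sup>2)"
    by (simp only: DERIV_imp_deriv norm_mult norm_power norm_divide abs N_def norm_of_nat)
  also have "cmod (of_real (- (a + k))) = a + k"
    using assms by (simp only: norm_of_real)
  finally have dr: "cmod (deriv r 1) = real n * N ^ j * ((a + k) / (a - 1)\<^sup>2)" .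
  have r1: "cmod (r 1) = N ^ n"
    by (simp add: r_def norm_power norm_divide abs N_def)
  have norm: "circle_norm r = N ^ n"
    unfolding r_def N_def by (rule extremal_circle_norm[OF assms(1,2)])
  have N: "N > 0" using assms by (simp add: N_def)
  have B: "cmod (deriv (blaschke n (\<lambda>_. of_real a)) 1) = real n * ((a\<^sup>2 - 1) / (a - 1)\<^sup>2)"
    using assms(2) by (subst cmod_deriv_blaschke) (auto simp: poisson_sum_def abs)
  \<comment> \<open>This is the identity for n = 1; multiplying by n N^j yields the general
    case.\<close>
  have "(a + k) / (a - 1)\<^sup>2 = 1 / 2 * ((a\<^sup>2 - 1) / (a - 1)\<^sup>2 - (k - 1) / (k + 1)) * N"
  proof -
    have nz: "a - 1 \<noteq> 0" "k + 1 \<noteq> 0" using assms by auto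
    have "a\<^sup>2 - 1 = (a + 1) * (a - 1)" by (simp add: power2_eq_square algebra_simps)
    then have "(a\<^sup>2 - 1) / (a - 1)\<^sup>2 - (k - 1) / (k + 1) = (a + 1) / (a - 1) - (k - 1) / (k + 1)"
      by (simp add: power2_eq_square)
    also have "\<dots> = ((a + 1) * (k + 1) - (k - 1) * (a - 1)) / ((a - 1) * (k + 1))"
      using nz by (rule diff_frac_eq)
    also have "(a + 1) * (k + 1) - (k - 1) * (a - 1) = 2 * (a + k)"
      by (simp add: algebra_simps)
    finally have "(a\<^sup>2 - 1) / (a - 1)\<^sup>2 - (k - 1) / (k + 1) = 2 * (a + k) / ((a - 1) * (k + 1))" .
    moreover have "u / x\<^sup>2 = 1 / 2 * (2 * u / (x * y)) * (y / x)" if "y \<noteq> 0" for u x y :: real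
      using that by (simp add: power2_eq_square)
    ultimately show ?thesis
      using nz(2) by (simp only: N_def add.commute[of 1 k])
  qed
  moreover have "real n * N ^ j * (1 / 2 * (A - C) * N) = 1 / 2 * (real n * A - real n * C) * N ^ n" for A C
    unfolding Suc power_Suc right_diff_distrib[symmetric] by simp
  ultimately have "cmod (deriv r 1)
      = 1 / 2 * (real n * ((a\<^sup>2 - 1) / (a - 1)\<^sup>2) - real n * ((k - 1) / (k + 1))) * N ^ n"
    by (simp only: dr)
  also have "real n * ((k - 1) / (k + 1)) = real n * (k - 1) * (N ^ n)\<^sup>2 / ((k + 1) * (N ^ n)\<^sup>2)"
    using N by simp
  finally show ?thesis
    unfolding B r1 norm m by simp
qed

theorem corollary1p3:
  "(\<forall>(n::nat) (k::real) (a :: nat \<Rightarrow> complex) (p :: complex poly) r B m.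
      1 \<le> k \<longrightarrow>
      (\<forall>j\<in>{1..n}. cmod (a j) > 1) \<longrightarrow>
      degree p = n \<longrightarrow>
      (\<forall>z. poly p z = 0 \<longrightarrow> k \<le> cmod z) \<longrightarrow>
      r = rat_fun p (pole_poly n a) \<longrightarrow>
      B = blaschke n a \<longrightarrow>
      m = circle_min k r \<longrightarrow>
      (\<forall>z. cmod z = 1 \<longrightarrow>
        cmod (deriv r z) \<le>
          1 / 2 * (cmod (deriv B z)
                   - real n * (k - 1) * (cmod (r z) - m)\<^sup>2 / ((k + 1) * (circle_norm r - m)\<^sup>2))
                * (circle_norm r - m)))
   \<and>
   (\<forall>(n::nat) (k::real) (a::real) r B m.
      1 \<le> k \<longrightarrow>
      1 < a \<longrightarrow>
      r = (\<lambda>z. ((z + of_real k) / (z - of_real a)) ^ n) \<longrightarrow>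
      B = (\<lambda>z. ((1 - of_real a * z) / (z - of_real a)) ^ n) \<longrightarrow>
      m = circle_min k r \<longrightarrow>
      r = rat_fun ([:of_real k, 1:] ^ n) (pole_poly n (\<lambda>_. of_real a)) \<and>
      B = blaschke n (\<lambda>_. of_real a) \<and>
      cmod (deriv r 1) =
        1 / 2 * (cmod (deriv B 1)
                 - real n * (k - 1) * (cmod (r 1) - m)\<^sup>2 / ((k + 1) * (circle_norm r - m)\<^sup>2))
              * (circle_norm r - m))"
proof (intro conjI allI impI)
  fix n :: nat and k :: real and a :: "nat \<Rightarrow> complex" and p :: "complex poly" and r B m z
  assume "1 \<le> k" "\<forall>j\<in>{1..n}. cmod (a j) > 1" "degree p = n"
    "\<forall>z. poly p z = 0 \<longrightarrow> k \<le> cmod z" "r = rat_fun p (pole_poly n a)"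
    "B = blaschke n a" "m = circle_min k r" "cmod z = 1"
  then show "cmod (deriv r z) \<le> 1 / 2 * (cmod (deriv B z)
      - real n * (k - 1) * (cmod (r z) - m)\<^sup>2 / ((k + 1) * (circle_norm r - m)\<^sup>2))
        * (circle_norm r - m)"
    using deriv_rat_fun_bound[where k = k and n = n and a = a and p = p and z = z] by simp
next
  fix n :: nat and k a :: real and r B :: "complex \<Rightarrow> complex" and m :: real
  assume k: "1 \<le> k" "1 < a"
    and r: "r = (\<lambda>z. ((z + of_real k) / (z - of_real a)) ^ n)"
    and B: "B = (\<lambda>z. ((1 - of_real a * z) / (z - of_real a)) ^ n)"
    and m: "m = circle_min k r"
  show "r = rat_fun ([:of_real k, 1:] ^ n) (pole_poly n (\<lambda>_. of_real a))"
    using extremal_rat_fun[OF k] r by simp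
  show B': "B = blaschke n (\<lambda>_. of_real a)"
    by (simp add: B blaschke_def fun_eq_iff)
  show "cmod (deriv r 1) = 1 / 2 * (cmod (deriv B 1)
      - real n * (k - 1) * (cmod (r 1) - m)\<^sup>2 / ((k + 1) * (circle_norm r - m)\<^sup>2))
        * (circle_norm r - m)"
    using extremal_equality[OF k] unfolding B' m r by blast
qed

end
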